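(* Let $k\geq 2$ be an integer. Every countable digraph is $(1/k)$-majority $(2k+1)$-choosable: for every countable digraph $D$ and every system of lists $(L(v))_{v\in V(D)}$ with $|L(v)|=2k+1$, there is a $(1/k)$-majority colouring $\chi$ of $D$ with $\chi(v)\in L(v)$ for every $v$.
   Context: For a digraph $D$, a $(1/k)$-majority colouring is an assignment $\chi$ of colours to vertices such that for every vertex $v$: if $v$ has finite outdegree, at most a $1/k$ proportion of the out-edges $v\to u$ satisfy $\chi(u)=\chi(v)$; if $v$ has infinite outdegree, $v$ has infinitely many outneighbours $u$ with $\chi(u)\neq\chi(v)$. *)

theory Defs
  imports Complex_Main "HOL-Library.Countable_Set" "Graph_Theory.Digraph"
begin

text \<open>
  The library locale \<open>digraph\<close> includes finiteness, so possibly infinite digraphs without loops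
  and parallel arcs are given by \<open>loopfree_digraph\<close> and \<open>nomulti_digraph\<close>.
  The values of \<open>\<chi>\<close> outside \<open>verts G\<close> are irrelevant for well-formed \<open>G\<close>.
\<close>

definition majority_colouring ::
  "nat \<Rightarrow> ('a, 'b) pre_digraph \<Rightarrow> ('a \<Rightarrow> 'c) \<Rightarrow> bool" where
  "majority_colouring k G \<chi> \<longleftrightarrow>
     (\<forall>v \<in> verts G.
        (finite (out_arcs G v) \<longrightarrow>
           real (card {e \<in> out_arcs G v. \<chi> (head G e) = \<chi> v})
             \<le> 1 / real k * real (out_degree G v)) \<and>
        (infinite (out_arcs G v) \<longrightarrow>
           infinite {u. v \<rightarrow>\<^bsub>G\<^esub> u \<and> \<chi> u \<noteq> \<chi> v}))"

end

theory Submission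
  imports Defs "HOL-Library.FuncSet"
begin

text \<open>
  Enumerate the vertices. Every vertex \<open>v\<close> of infinite outdegree can be given infinitely many
  private outneighbours of larger index, no vertex being private to two others. Going through the
  enumeration, colour each vertex differently from its owner, if it has one, and keep this colour
  on the vertices of infinite outdegree. Removing the colour of the owner from the list of each
  vertex of finite outdegree leaves at least \<open>2 * k\<close> colours, so it remains to colour the vertices
  of finite outdegree from lists of size \<open>2 * k\<close>, the others being precoloured.

  By compactness only a finite set \<open>S\<close> of vertices of finite outdegree matters. For \<open>s < 1\<close> close
  to 1 there are positive weights \<open>x\<close> on \<open>S\<close> such that, if \<open>u\<close> spreads \<open>x u\<close> evenly over its
  out-arcs, each \<open>v\<close> receives at most \<open>x v / s\<close>. In a colouring that minimises the total weight of
  the monochromatic arcs leaving \<open>S\<close>, averaging over the \<open>2 * k\<close> colours available at \<open>v\<close> shows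
  that monochromatic out-arcs have at most the proportion \<open>(1 + 1 / s) / (2 * k)\<close>; as this
  proportion has denominator \<open>card (N v)\<close>, it is at most \<open>1 / k\<close>.
\<close>

section \<open>Finite digraphs: weights and minimal colourings\<close>

lemma ex_subinvariant_weight:
  fixes p :: "'a \<Rightarrow> 'a \<Rightarrow> real"
  assumes fin: "finite S" and s: "0 < s" "s < 1"
    and p_nonneg: "\<And>u v. 0 \<le> p u v"
    and p_sum: "\<And>u. u \<in> S \<Longrightarrow> (\<Sum>v\<in>S. p u v) \<le> 1"
  obtains x where "\<And>v. v \<in> S \<Longrightarrow> 0 < x v"
    and "\<And>v. v \<in> S \<Longrightarrow> s * (\<Sum>u\<in>S. x u * p u v) \<le> x v"
proof -
  \<comment> \<open>The powers of \<open>s * p\<close> applied to the all-one vector lose mass geometrically, so a finite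
    partial sum of them is already subinvariant.\<close>
  define y where "y = rec_nat (\<lambda>_::'a. 1::real) (\<lambda>_ z v. s * (\<Sum>u\<in>S. z u * p u v))"
  have y0: "y 0 v = 1" for v by (simp add: y_def)
  have ySuc: "y (Suc i) v = s * (\<Sum>u\<in>S. y i u * p u v)" for i v by (simp add: y_def)
  have y_nonneg: "0 \<le> y i v" for i v
    by (induction i arbitrary: v) (auto simp: y0 ySuc s less_imp_le p_nonneg intro!: mult_nonneg_nonneg sum_nonneg)
  have mass: "(\<Sum>v\<in>S. y i v) \<le> s ^ i * card S" for i
  proof (induction i)
    case 0
    then show ?case by (simp add: y0)
  next
    case (Suc i)
    have "(\<Sum>v\<in>S. y (Suc i) v) = s * (\<Sum>u\<in>S. \<Sum>v\<in>S. y i u * p u v)"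
      unfolding ySuc by (subst sum.swap) (simp only: sum_distrib_left)
    also have "\<dots> = s * (\<Sum>u\<in>S. y i u * (\<Sum>v\<in>S. p u v))"
      by (simp add: sum_distrib_left)
    also have "\<dots> \<le> s * (\<Sum>u\<in>S. y i u)"
      using s y_nonneg p_sum
      by (intro mult_left_mono sum_mono) (auto intro: mult_left_le)
    also have "\<dots> \<le> s * (s ^ i * card S)"
      using Suc s by (intro mult_left_mono) auto
    finally show ?case by simp
  qed
  \<comment> \<open>The \<open>+ 1\<close> in the denominator covers empty \<open>S\<close>. The aim
    is total mass at most 1, so that no entry of \<open>y (Suc n)\<close> exceeds 1, the value of
    \<open>y 0\<close>.\<close>
  obtain n where "s ^ n < 1 / (real (card S) + 1)"
    using real_arch_pow_inv[of "1 / (real (card S) + 1)" s] s by auto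
  then have "s ^ Suc n < 1 / (real (card S) + 1)"
    using s by (smt (verit) mult_left_le_one_le power_Suc zero_less_power)
  then have "s ^ Suc n * (real (card S) + 1) < 1" by (simp add: field_simps)
  moreover have "0 \<le> s ^ Suc n" using s by simp
  ultimately have "s ^ Suc n * card S \<le> 1" by (simp add: algebra_simps)
  then have yn: "y (Suc n) v \<le> 1" if "v \<in> S" for v
    using mass[of "Suc n"] member_le_sum[OF that, of "y (Suc n)"] y_nonneg fin by force
  define x where "x v = (\<Sum>i<Suc n. y i v)" for v
  show thesis
  proof
    fix v assume v: "v \<in> S"
    have "y 0 v \<le> x v"
      unfolding x_def by (rule member_le_sum) (auto simp: y_nonneg)
    then show "0 < x v" by (simp add: y0)
    \<comment> \<open>Applying \<open>s * p\<close> shifts the partial sum by one index: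
      \<open>y 0 v\<close> is lost and \<open>y (Suc n) v\<close>, which is no larger, is
      gained.\<close>
    have "s * (\<Sum>u\<in>S. x u * p u v) = (\<Sum>i<Suc n. y (Suc i) v)"
      unfolding x_def ySuc sum_distrib_left[symmetric] sum_distrib_right
      by (subst sum.swap) simp
    also have "\<dots> = x v - y 0 v + y (Suc n) v"
      unfolding x_def using sum.lessThan_Suc_shift[of "\<lambda>i. y i v" "Suc n"] by simp
    also have "\<dots> \<le> x v"
      using yn[OF v] by (simp add: y0)
    finally show "s * (\<Sum>u\<in>S. x u * p u v) \<le> x v" .
  qed
qed

text \<open>\<open>N v\<close> may leave \<open>S\<close>, where \<open>\<chi>0\<close> is a fixed
  precolouring. This serves both for vertices of infinite outdegree and for those beyond a finite
  stage of the compactness argument.\<close>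

lemma finite_majority_choosable:
  fixes N :: "'a \<Rightarrow> 'a set" and L :: "'a \<Rightarrow> 'c set"
  assumes fin: "finite S" and k: "k > 0"
    and N: "\<And>v. v \<in> S \<Longrightarrow> finite (N v)" "\<And>v. v \<in> S \<Longrightarrow> v \<notin> N v"
    and L: "\<And>v. v \<in> S \<Longrightarrow> finite (L v)" "\<And>v. v \<in> S \<Longrightarrow> 2 * k \<le> card (L v)"
  obtains \<chi> where "\<And>v. v \<in> S \<Longrightarrow> \<chi> v \<in> L v" and "\<And>v. v \<notin> S \<Longrightarrow> \<chi> v = \<chi>0 v"
    and "\<And>v. v \<in> S \<Longrightarrow> k * card {u \<in> N v. \<chi> u = \<chi> v} \<le> card (N v)"
proof -
  define M where "M = (\<Sum>v\<in>S. card (N v))"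
  have M: "card (N v) \<le> M" if "v \<in> S" for v
    unfolding M_def by (rule member_le_sum) (use that fin in auto)
  \<comment> \<open>This gives \<open>1 / s = 1 + 1 / (M + 1)\<close>, an excess too small to be seen by any outdegree.\<close>
  define s where "s = (real M + 1) / (real M + 2)"
  have s: "0 < s" "s < 1" by (auto simp: s_def)
  define p where "p u v = (if v \<in> N u then 1 / real (card (N u)) else 0)" for u v
  have "(\<Sum>v\<in>S. p u v) \<le> 1" if "u \<in> S" for u
  proof -
    have "(\<Sum>v\<in>S. p u v) = real (card (S \<inter> N u)) / real (card (N u))"
      using fin by (simp add: p_def sum.If_cases Int_def)
    also have "\<dots> \<le> 1"
      using card_mono[OF N(1)[OF that], of "S \<inter> N u"] by (cases "card (N u) = 0") (auto simp: divide_le_eq_1)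
    finally show ?thesis .
  qed
  moreover have "0 \<le> p u v" for u v by (simp add: p_def)
  ultimately obtain x where x_pos: "\<And>v. v \<in> S \<Longrightarrow> 0 < x v"
    and x_sub: "\<And>v. v \<in> S \<Longrightarrow> s * (\<Sum>u\<in>S. x u * p u v) \<le> x v"
    using ex_subinvariant_weight[OF fin s, of p] by blast
  \<comment> \<open>The share of \<open>x u\<close> carried by each out-arc of \<open>u\<close>:
    \<open>a u = x u * p u v\<close> for \<open>v\<close> in \<open>N u\<close>.\<close>
  define a where "a u = x u / card (N u)" for u
  have a_nonneg: "0 \<le> a u" if "u \<in> S" for u
    using x_pos[OF that] by (simp add: a_def)
  define \<Phi> where "\<Phi> \<chi> = (\<Sum>u\<in>S. a u * card {w \<in> N u. \<chi> w = \<chi> u})" for \<chi> :: "'a \<Rightarrow> 'c"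
  define C where "C = (\<lambda>f v. if v \<in> S then f v else \<chi>0 v) ` Pi\<^sub>E S L"
  have "finite C"
    unfolding C_def using fin L(1) by (intro finite_imageI finite_PiE)
  moreover have "C \<noteq> {}"
    using L k by (fastforce simp: C_def PiE_eq_empty_iff)
  ultimately obtain \<chi> where "\<chi> \<in> C" and min: "\<And>\<psi>. \<psi> \<in> C \<Longrightarrow> \<Phi> \<chi> \<le> \<Phi> \<psi>"
    using ex_is_arg_min_if_finite[of C \<Phi>] by (auto simp: is_arg_min_linorder)
  then have \<chi>: "\<chi> v \<in> L v" if "v \<in> S" for v
    using that by (auto simp: C_def)
  have \<chi>_off: "\<chi> v = \<chi>0 v" if "v \<notin> S" for v
    using that \<open>\<chi> \<in> C\<close> by (auto simp: C_def)
  have upd: "\<chi>(v := c) \<in> C" if "v \<in> S" "c \<in> L v" for v c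
    unfolding C_def
  proof (rule image_eqI)
    show "\<chi>(v := c) = (\<lambda>w. if w \<in> S then restrict (\<chi>(v := c)) S w else \<chi>0 w)"
      using that by (auto simp: \<chi>_off)
    show "restrict (\<chi>(v := c)) S \<in> Pi\<^sub>E S L"
      using that \<chi> by auto
  qed
  have "k * card {u \<in> N v. \<chi> u = \<chi> v} \<le> card (N v)" if v: "v \<in> S" for v
  proof (cases "card (N v) = 0")
    case True
    then show ?thesis using N(1)[OF v] by simp
  next
    case False
    \<comment> \<open>\<open>Q c\<close> is the monochromatic weight at \<open>v\<close> after recolouring \<open>v\<close> with \<open>c\<close>.\<close>
    define Q where "Q c = a v * card {w \<in> N v. \<chi> w = c} +
      (\<Sum>u\<in>S-{v}. a u * (if v \<in> N u \<and> \<chi> u = c then 1 else 0))" for c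
    \<comment> \<open>\<open>R\<close> does not involve the colour of \<open>v\<close>, so
      minimality of \<open>\<Phi> \<chi>\<close> becomes minimality of
      \<open>Q (\<chi> v)\<close>.\<close>
    define R where "R = (\<Sum>u\<in>S-{v}. a u * card {w \<in> N u - {v}. \<chi> w = \<chi> u})"
    have \<Phi>_upd: "\<Phi> (\<chi>(v := c)) = Q c + R" for c
    proof -
      have "card {w \<in> N u. (\<chi>(v := c)) w = (\<chi>(v := c)) u} =
          (if v \<in> N u \<and> \<chi> u = c then 1 else 0) + card {w \<in> N u - {v}. \<chi> w = \<chi> u}"
        if u: "u \<in> S - {v}" for u
      proof -
        have "{w \<in> N u. (\<chi>(v := c)) w = (\<chi>(v := c)) u} =
          (if v \<in> N u \<and> \<chi> u = c then insert v {w \<in> N u - {v}. \<chi> w = \<chi> u}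
           else {w \<in> N u - {v}. \<chi> w = \<chi> u})"
          using u by auto
        then show ?thesis using N(1)[of u] u by simp
      qed
      then have "(\<Sum>u\<in>S-{v}. a u * card {w \<in> N u. (\<chi>(v := c)) w = (\<chi>(v := c)) u}) =
          (\<Sum>u\<in>S-{v}. a u * (if v \<in> N u \<and> \<chi> u = c then 1 else 0)) + R"
        unfolding R_def sum.distrib[symmetric]
        by (intro sum.cong refl) (simp add: algebra_simps)
      moreover have "{w \<in> N v. (\<chi>(v := c)) w = (\<chi>(v := c)) v} = {w \<in> N v. \<chi> w = c}"
        using N(2)[OF v] by auto
      ultimately show ?thesis
        unfolding \<Phi>_def Q_def sum.remove[OF fin v] by (simp only: fun_upd_same)
    qed
    have "Q (\<chi> v) \<le> Q c" if "c \<in> L v" for c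
      using min[OF upd[OF v that]] \<Phi>_upd[of c] \<Phi>_upd[of "\<chi> v"] by simp
    then have "real (card (L v)) * Q (\<chi> v) \<le> (\<Sum>c\<in>L v. Q c)"
      by (intro sum_bounded_below)
    moreover have Q_ge: "a v * card {w \<in> N v. \<chi> w = \<chi> v} \<le> Q (\<chi> v)"
      unfolding Q_def by (auto intro!: sum_nonneg a_nonneg mult_nonneg_nonneg)
    moreover have "0 \<le> Q (\<chi> v)"
      using Q_ge a_nonneg[OF v] by (meson mult_nonneg_nonneg of_nat_0_le_iff order_trans)
    moreover have "real (2 * k) \<le> card (L v)" using L(2)[OF v] by linarith
    ultimately have le: "2 * k * (a v * card {w \<in> N v. \<chi> w = \<chi> v}) \<le> (\<Sum>c\<in>L v. Q c)"
      by (smt (verit, ccfv_SIG) mult_left_mono mult_right_mono of_nat_0_le_iff)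
    have "(\<Sum>c\<in>L v. card {w \<in> N v. \<chi> w = c}) \<le> card (N v)"
    proof -
      have "(\<Sum>c\<in>L v. card {w \<in> N v. \<chi> w = c}) = card (\<Union>c\<in>L v. {w \<in> N v. \<chi> w = c})"
        using N(1)[OF v] L(1)[OF v] by (intro card_UN_disjoint[symmetric]) auto
      also have "\<dots> \<le> card (N v)" using N(1)[OF v] by (intro card_mono) auto
      finally show ?thesis .
    qed
    then have out: "(\<Sum>c\<in>L v. a v * card {w \<in> N v. \<chi> w = c}) \<le> x v"
      using x_pos[OF v] False
      by (simp add: a_def sum_distrib_left[symmetric] sum_divide_distrib[symmetric]
          of_nat_sum[symmetric] field_simps del: of_nat_sum)
    \<comment> \<open>An arc from \<open>u\<close> to \<open>v\<close> is monochromatic only for the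
      choice \<open>c = \<chi> u\<close>, so all colours together pay at most the inflow into
      \<open>v\<close>.\<close>
    have "(\<Sum>c\<in>L v. \<Sum>u\<in>S-{v}. a u * (if v \<in> N u \<and> \<chi> u = c then 1 else 0)) =
        (\<Sum>u\<in>S-{v}. \<Sum>c\<in>L v. if c = \<chi> u then (if v \<in> N u then a u else 0) else 0)"
      by (subst sum.swap) (auto intro!: sum.cong)
    also have "\<dots> \<le> (\<Sum>u\<in>S-{v}. x u * p u v)"
      using L(1)[OF v] x_pos by (intro sum_mono) (auto simp: a_def p_def less_imp_le)
    also have "\<dots> \<le> (\<Sum>u\<in>S. x u * p u v)"
      using fin x_pos by (intro sum_mono2) (auto simp: p_def less_imp_le)
    also have "\<dots> \<le> x v / s"
      using x_sub[OF v] s by (simp add: field_simps)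
    finally have "(\<Sum>c\<in>L v. Q c) \<le> x v + x v / s"
      using out unfolding Q_def by (simp add: sum.distrib)
    with le have "x v * (2 * k * card {w \<in> N v. \<chi> w = \<chi> v} / card (N v)) \<le> x v * (1 + 1 / s)"
      by (simp add: a_def algebra_simps)
    then have "2 * k * card {w \<in> N v. \<chi> w = \<chi> v} / card (N v) \<le> 1 + 1 / s"
      using x_pos[OF v] by (simp only: mult_le_cancel_left_pos)
    then have "2 * k * card {w \<in> N v. \<chi> w = \<chi> v} \<le> card (N v) * (1 + 1 / s)"
      using False by (simp add: pos_divide_le_eq mult.commute)
    also have "\<dots> = 2 * card (N v) + card (N v) / (real M + 1)"
      by (simp add: s_def field_simps)
    \<comment> \<open>The surplus is below 1, so it vanishes between integers.\<close>
    also have "\<dots> < 2 * card (N v) + 1"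
      using M[OF v] by (simp add: field_simps)
    finally show ?thesis
      by linarith
  qed
  with \<chi> \<chi>_off show thesis by (rule that)
qed

section \<open>Compactness\<close>

text \<open>Koenig's argument: values are fixed one place at a time, and by pigeonhole some value
  keeps infinitely many of the \<open>X m\<close> alive.\<close>

lemma ex_infinitely_often_approximated:
  fixes X :: "nat \<Rightarrow> nat \<Rightarrow> 'c"
  assumes fin: "\<And>i. finite (range (\<lambda>m. X m i))"
  obtains \<chi> where "\<And>n. infinite {m. \<forall>i<n. X m i = \<chi> i}"
proof -
  \<comment> \<open>The implication guarantees a choice of \<open>c\<close> after every prefix, even
    one shared by finitely many \<open>X m\<close> only; its premise is supplied by the induction
    below.\<close>
  define P where "P \<chi> n c \<longleftrightarrow> (infinite {m. \<forall>i<n. X m i = \<chi> i} \<longrightarrow>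
      infinite {m. (\<forall>i<n. X m i = \<chi> i) \<and> X m n = c})" for \<chi> :: "nat \<Rightarrow> 'c" and n c
  have "\<exists>\<chi>. \<forall>n. P \<chi> n (\<chi> n)"
  proof (rule dependent_wellorder_choice)
    fix r and f g :: "nat \<Rightarrow> 'c" and n :: nat assume "\<And>i. i < n \<Longrightarrow> f i = g i"
    then show "P f n r = P g n r" by (simp add: P_def)
  next
    fix n f
    show "\<exists>c. P f n c"
    proof (cases "infinite {m. \<forall>i<n. X m i = f i}")
      case True
      have "finite ((\<lambda>m. X m n) ` {m. \<forall>i<n. X m i = f i})"
        by (rule finite_subset[OF _ fin[of n]]) auto
      from pigeonhole_infinite[OF True this] show ?thesis
        by (auto simp: P_def)
    qed (simp add: P_def)
  qed
  then obtain \<chi> where \<chi>: "P \<chi> n (\<chi> n)" for n by blast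
  have "infinite {m. \<forall>i<n. X m i = \<chi> i}" for n
  proof (induction n)
    case (Suc n)
    with \<chi>[of n] have "infinite {m. (\<forall>i<n. X m i = \<chi> i) \<and> X m n = \<chi> n}"
      by (simp add: P_def)
    then show ?case by (simp add: All_less_Suc conj_commute)
  qed simp
  then show thesis by (rule that)
qed

text \<open>The conditions at \<open>v\<close> involve only the colours on \<open>v\<close> and the
  finite set \<open>N v\<close>, so they pass to a limit of colourings of growing initial
  segments.\<close>

lemma locally_finite_majority_choosable:
  fixes N :: "nat \<Rightarrow> nat set" and L :: "nat \<Rightarrow> 'c set"
  assumes k: "k > 0"
    and N: "\<And>v. v \<in> F \<Longrightarrow> finite (N v)" "\<And>v. v \<in> F \<Longrightarrow> v \<notin> N v"
    and L: "\<And>v. v \<in> F \<Longrightarrow> finite (L v)" "\<And>v. v \<in> F \<Longrightarrow> 2 * k \<le> card (L v)"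
  obtains \<chi> where "\<And>v. v \<in> F \<Longrightarrow> \<chi> v \<in> L v" and "\<And>v. v \<notin> F \<Longrightarrow> \<chi> v = \<chi>0 v"
    and "\<And>v. v \<in> F \<Longrightarrow> k * card {u \<in> N v. \<chi> u = \<chi> v} \<le> card (N v)"
proof -
  define P where "P n \<chi> \<longleftrightarrow> (\<forall>v\<in>F \<inter> {..<n}. \<chi> v \<in> L v) \<and>
      (\<forall>v. v \<notin> F \<inter> {..<n} \<longrightarrow> \<chi> v = \<chi>0 v) \<and>
      (\<forall>v\<in>F \<inter> {..<n}. k * card {u \<in> N v. \<chi> u = \<chi> v} \<le> card (N v))" for n \<chi>
  have "\<exists>\<chi>. P n \<chi>" for n
    unfolding P_def
    by (rule finite_majority_choosable[of "F \<inter> {..<n}" k N L \<chi>0]) (use k N L in auto)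
  then obtain X where "\<And>n. P n (X n)" by metis
  then have X: "\<And>n v. v \<in> F \<Longrightarrow> v < n \<Longrightarrow> X n v \<in> L v"
    and X_off: "\<And>n v. \<not> (v \<in> F \<and> v < n) \<Longrightarrow> X n v = \<chi>0 v"
    and X_maj: "\<And>n v. v \<in> F \<Longrightarrow> v < n \<Longrightarrow> k * card {u \<in> N v. X n u = X n v} \<le> card (N v)"
    by (simp_all add: P_def)
  have "finite (range (\<lambda>m. X m v))" for v
  proof (rule finite_subset)
    have "X m v \<in> (if v \<in> F then insert (\<chi>0 v) (L v) else {\<chi>0 v})" for m
      using X[of v m] X_off[of v m] by auto
    then show "range (\<lambda>m. X m v) \<subseteq> (if v \<in> F then insert (\<chi>0 v) (L v) else {\<chi>0 v})"
      by blast
  qed (use L in auto)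
  then obtain \<chi> where \<chi>: "\<And>n. infinite {m. \<forall>i<n. X m i = \<chi> i}"
    using ex_infinitely_often_approximated by blast
  \<comment> \<open>\<open>m > v\<close> matters because \<open>X m\<close> obeys the lists and the
    majority condition only below \<open>m\<close>.\<close>
  have agree: "\<exists>m>v. \<chi> v = X m v \<and> (\<forall>u\<in>A. \<chi> u = X m u)" if A: "finite A" for v A
  proof -
    obtain n where n: "\<forall>u\<in>insert v A. u < n"
      using A finite_nat_set_iff_bounded[of "insert v A"] by auto
    obtain m where "m > v" "\<forall>i<n. X m i = \<chi> i"
      using \<chi>[of n] unfolding infinite_nat_iff_unbounded by blast
    then show ?thesis using n by (intro exI[of _ m]) auto
  qed
  show thesis
  proof
    fix v
    show "\<chi> v = \<chi>0 v" if "v \<notin> F" using agree[of "{}" v] X_off that by auto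
    assume v: "v \<in> F"
    obtain m where m: "m > v" "\<chi> v = X m v" "\<forall>u\<in>N v. \<chi> u = X m u"
      using agree[OF N(1)[OF v]] by blast
    then show "\<chi> v \<in> L v" using X[OF v] by simp
    have "{u \<in> N v. \<chi> u = \<chi> v} = {u \<in> N v. X m u = X m v}" using m by auto
    then show "k * card {u \<in> N v. \<chi> u = \<chi> v} \<le> card (N v)"
      using X_maj[OF v m(1)] by simp
  qed
qed

section \<open>Vertices of infinite outdegree\<close>

text \<open>\<open>par u\<close> is the owner of \<open>u\<close>. Vertices are served in an order
  in which each recurs infinitely often, every turn taking a number larger than all taken
  before.\<close>

lemma ex_private_outneighbours:
  fixes N :: "nat \<Rightarrow> nat set"
  obtains par :: "nat \<Rightarrow> nat option"
  where "\<And>u v. par u = Some v \<Longrightarrow> v < u"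
    and "\<And>v. infinite (N v) \<Longrightarrow> infinite {u \<in> N v. par u = Some v}"
proof -
  \<comment> \<open>Each \<open>v\<close> is the first component of infinitely many decoded
    pairs.\<close>
  define w where "w n = fst (prod_decode n)" for n
  have "\<exists>g. \<forall>n. (infinite (N (w n)) \<longrightarrow> g n \<in> N (w n)) \<and> w n < g n \<and> g n < g (Suc n)"
  proof -
    define P where "P n y \<longleftrightarrow> (infinite (N (w n)) \<longrightarrow> y \<in> N (w n)) \<and> w n < y" for n y
    have step: "\<exists>y. P n y \<and> x < y" for n x
    proof (cases "infinite (N (w n))")
      case True
      then obtain y where "y > max x (w n)" "y \<in> N (w n)"
        unfolding infinite_nat_iff_unbounded by blast
      then show ?thesis by (auto simp: P_def)
    next
      case False
      \<comment> \<open>A dummy value that only keeps \<open>g\<close> increasing.\<close>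
      then show ?thesis by (intro exI[of _ "Suc (max x (w n))"]) (auto simp: P_def)
    qed
    have "\<exists>g. \<forall>n. P n (g n) \<and> g n < g (Suc n)"
      by (rule dependent_nat_choice) (use step in blast)+
    then show ?thesis by (auto simp: P_def)
  qed
  then obtain g where g: "\<And>n. infinite (N (w n)) \<Longrightarrow> g n \<in> N (w n)" "\<And>n. w n < g n"
    and g_mono: "\<And>n. g n < g (Suc n)"
    by auto
  have inj: "inj g" using g_mono by (intro strict_mono_imp_inj_on) (simp add: strict_mono_Suc_iff)
  define par where "par u = (if u \<in> range g then Some (w (inv g u)) else None)" for u
  have par_g: "par (g n) = Some (w n)" for n
    by (simp add: par_def inj)
  show thesis
  proof
    show "v < u" if "par u = Some v" for u v
      using that g(2) inj by (auto simp: par_def split: if_splits)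
    fix v assume v: "infinite (N v)"
    have wv: "w (prod_encode (v, i)) = v" for i by (simp add: w_def)
    have "(\<lambda>i. g (prod_encode (v, i))) ` UNIV \<subseteq> {u \<in> N v. par u = Some v}"
      using g(1) v wv par_g by auto metis
    moreover have "inj (\<lambda>i. g (prod_encode (v, i)))"
      using inj by (auto intro!: injI dest: injD)
    ultimately show "infinite {u \<in> N v. par u = Some v}"
      using finite_subset range_inj_infinite by blast
  qed
qed

lemma nat_majority_choosable:
  fixes N :: "nat \<Rightarrow> nat set" and L :: "nat \<Rightarrow> 'c set"
  assumes k: "k > 0" and N: "\<And>v. v \<notin> N v" and L: "\<And>v. card (L v) = 2 * k + 1"
  obtains \<chi> where "\<And>v. \<chi> v \<in> L v"
    and "\<And>v. finite (N v) \<Longrightarrow> k * card {u \<in> N v. \<chi> u = \<chi> v} \<le> card (N v)"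
    and "\<And>v. infinite (N v) \<Longrightarrow> infinite {u \<in> N v. \<chi> u \<noteq> \<chi> v}"
proof -
  obtain par where par_less: "\<And>u v. par u = Some v \<Longrightarrow> v < u"
    and par_inf: "\<And>v. infinite (N v) \<Longrightarrow> infinite {u \<in> N v. par u = Some v}"
    using ex_private_outneighbours[of N] by blast
  have fin: "finite (L v)" for v using L[of v] by (intro card_ge_0_finite) simp
  \<comment> \<open>Owners have smaller index, so \<open>rest f u\<close> depends only on
    \<open>f\<close> below \<open>u\<close> and the choice of \<open>\<chi>0\<close> can be
    recursive.\<close>
  define rest where "rest f u = L u - (case par u of None \<Rightarrow> {} | Some v \<Rightarrow> {f v})"
    for f :: "nat \<Rightarrow> 'c" and u
  have card_rest: "2 * k \<le> card (rest f u)" for f u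
    using L[of u] fin[of u] by (auto simp: rest_def card_Diff_singleton_if split: option.split)
  have fin_rest: "finite (rest f u)" for f u
    using fin by (simp add: rest_def)
  have "\<exists>\<chi>0. \<forall>u. \<chi>0 u \<in> rest \<chi>0 u"
  proof (rule dependent_wellorder_choice)
    fix r and f g :: "nat \<Rightarrow> 'c" and u :: nat assume "\<And>v. v < u \<Longrightarrow> f v = g v"
    then show "(r \<in> rest f u) = (r \<in> rest g u)"
      by (auto simp: rest_def par_less split: option.splits)
  next
    fix u f
    show "\<exists>r. r \<in> rest f u" using card_rest[of f u] k by (cases "rest f u = {}") auto
  qed
  then obtain \<chi>0 where \<chi>0: "\<And>u. \<chi>0 u \<in> rest \<chi>0 u" by blast
  obtain \<chi> where \<chi>: "\<And>v. v \<in> {v. finite (N v)} \<Longrightarrow> \<chi> v \<in> rest \<chi>0 v"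
    and \<chi>_inf: "\<And>v. v \<notin> {v. finite (N v)} \<Longrightarrow> \<chi> v = \<chi>0 v"
    and maj: "\<And>v. v \<in> {v. finite (N v)} \<Longrightarrow> k * card {u \<in> N v. \<chi> u = \<chi> v} \<le> card (N v)"
    by (rule locally_finite_majority_choosable[of k "{v. finite (N v)}" N "rest \<chi>0" \<chi>0])
      (use k N fin_rest card_rest in auto)
  have rest: "\<chi> v \<in> rest \<chi>0 v" for v
    using \<chi>[of v] \<chi>_inf[of v] \<chi>0[of v] by (cases "finite (N v)") auto
  show thesis
  proof
    show "\<chi> v \<in> L v" for v using rest[of v] by (simp add: rest_def)
    show "k * card {u \<in> N v. \<chi> u = \<chi> v} \<le> card (N v)" if "finite (N v)" for v
      using maj that by simp
    fix v assume v: "infinite (N v)"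
    \<comment> \<open>\<open>v\<close> keeps the colour \<open>\<chi>0 v\<close>, which
      \<open>rest \<chi>0 u\<close> excludes whether or not \<open>u\<close> is recoloured.\<close>
    have "{u \<in> N v. par u = Some v} \<subseteq> {u \<in> N v. \<chi> u \<noteq> \<chi> v}"
    proof clarify
      fix u assume "par u = Some v" "\<chi> u = \<chi> v"
      then show False using rest[of u] \<chi>_inf[of v] v by (simp add: rest_def)
    qed
    then show "infinite {u \<in> N v. \<chi> u \<noteq> \<chi> v}"
      using par_inf[OF v] finite_subset by blast
  qed
qed

section \<open>Transfer to countable digraphs\<close>

lemma countable_majority_choosable:
  fixes N :: "'a \<Rightarrow> 'a set" and L :: "'a \<Rightarrow> 'c set"
  assumes k: "k > 0" and V: "countable V"
    and N: "\<And>v. v \<in> V \<Longrightarrow> N v \<subseteq> V" "\<And>v. v \<in> V \<Longrightarrow> v \<notin> N v"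
    and L: "\<And>v. v \<in> V \<Longrightarrow> card (L v) = 2 * k + 1"
  obtains \<chi> where "\<And>v. v \<in> V \<Longrightarrow> \<chi> v \<in> L v"
    and "\<And>v. v \<in> V \<Longrightarrow> finite (N v) \<Longrightarrow> k * card {u \<in> N v. \<chi> u = \<chi> v} \<le> card (N v)"
    and "\<And>v. v \<in> V \<Longrightarrow> infinite (N v) \<Longrightarrow> infinite {u \<in> N v. \<chi> u \<noteq> \<chi> v}"
proof (cases "V = {}")
  case True
  then show thesis using that by blast
next
  case False
  \<comment> \<open>For finite \<open>V\<close>, indices that code no vertex become copies of one
    under \<open>g\<close>; they get out-arcs but no in-arcs, so they are harmless.\<close>
  define f where "f = to_nat_on V"
  define g where "g = from_nat_into V"
  have g: "g i \<in> V" for i using False by (simp add: g_def from_nat_into)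
  have gf: "g (f v) = v" if "v \<in> V" for v using V that by (simp add: f_def g_def)
  have inj: "inj_on f V" using V by (simp add: f_def inj_on_to_nat_on)
  have "i \<notin> f ` N (g i)" for i
  proof
    assume "i \<in> f ` N (g i)"
    then obtain u where u: "u \<in> N (g i)" "i = f u" by blast
    then have "u \<in> V" using N(1) g by blast
    then show False using u gf N(2) by auto
  qed
  then obtain \<chi> where \<chi>: "\<And>i. \<chi> i \<in> L (g i)"
    and fin: "\<And>i. finite (f ` N (g i)) \<Longrightarrow>
      k * card {j \<in> f ` N (g i). \<chi> j = \<chi> i} \<le> card (f ` N (g i))"
    and inf: "\<And>i. infinite (f ` N (g i)) \<Longrightarrow> infinite {j \<in> f ` N (g i). \<chi> j \<noteq> \<chi> i}"
    using nat_majority_choosable[of k "\<lambda>i. f ` N (g i)" "\<lambda>i. L (g i)", OF k _ L[OF g]] by blast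
  show thesis
  proof
    fix v assume v: "v \<in> V"
    have injN: "inj_on f (N v)" using inj N(1)[OF v] by (rule inj_on_subset)
    show "\<chi> (f v) \<in> L v" using \<chi>[of "f v"] v by (simp add: gf)
    show "k * card {u \<in> N v. \<chi> (f u) = \<chi> (f v)} \<le> card (N v)" if "finite (N v)"
    proof -
      have "{j \<in> f ` N v. \<chi> j = \<chi> (f v)} = f ` {u \<in> N v. \<chi> (f u) = \<chi> (f v)}" by auto
      moreover have "inj_on f {u \<in> N v. \<chi> (f u) = \<chi> (f v)}"
        by (rule inj_on_subset[OF injN]) auto
      ultimately show ?thesis
        using fin[of "f v"] that injN by (simp add: gf v card_image)
    qed
    show "infinite {u \<in> N v. \<chi> (f u) \<noteq> \<chi> (f v)}" if "infinite (N v)"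
    proof -
      have "{j \<in> f ` N v. \<chi> j \<noteq> \<chi> (f v)} = f ` {u \<in> N v. \<chi> (f u) \<noteq> \<chi> (f v)}" by auto
      moreover have "infinite (f ` N v)" using that injN by (simp add: finite_image_iff)
      ultimately show ?thesis using inf[of "f v"] by (auto simp: gf v)
    qed
  qed
qed

theorem theorem9:
  fixes k :: nat
    and D :: "('a, 'b) pre_digraph"
    and L :: "'a \<Rightarrow> 'c set"
  assumes "k \<ge> 2"
    and "loopfree_digraph D" and "nomulti_digraph D"
    and "countable (verts D)"
    and "\<And>v. v \<in> verts D \<Longrightarrow> card (L v) = 2 * k + 1"
  shows "\<exists>\<chi> :: 'a \<Rightarrow> 'c. majority_colouring k D \<chi> \<and> (\<forall>v \<in> verts D. \<chi> v \<in> L v)"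
proof -
  interpret loopfree_digraph D by fact
  interpret nomulti_digraph D by fact
  define N where "N v = head D ` out_arcs D v" for v
  have k: "k > 0" using assms(1) by simp
  have NV: "N v \<subseteq> verts D" for v by (auto simp: N_def)
  have loop: "v \<notin> N v" for v using no_loops by (fastforce simp: N_def)
  \<comment> \<open>Without parallel arcs, counting out-arcs amounts to counting
    outneighbours.\<close>
  have inj: "inj_on (head D) (out_arcs D v)" for v
    by (auto intro!: inj_onI no_multi_arcs simp: arc_to_ends_def)
  obtain \<chi> where \<chi>: "\<And>v. v \<in> verts D \<Longrightarrow> \<chi> v \<in> L v"
    and fin: "\<And>v. v \<in> verts D \<Longrightarrow> finite (N v) \<Longrightarrow>
      k * card {u \<in> N v. \<chi> u = \<chi> v} \<le> card (N v)"
    and inf: "\<And>v. v \<in> verts D \<Longrightarrow> infinite (N v) \<Longrightarrow> infinite {u \<in> N v. \<chi> u \<noteq> \<chi> v}"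
    using countable_majority_choosable[of k "verts D" N L, OF k assms(4) NV loop assms(5)] by blast
  have "majority_colouring k D \<chi>"
    unfolding majority_colouring_def
  proof (intro ballI conjI impI)
    fix v assume v: "v \<in> verts D"
    {
      assume "finite (out_arcs D v)"
      moreover have "{u \<in> N v. \<chi> u = \<chi> v} = head D ` {e \<in> out_arcs D v. \<chi> (head D e) = \<chi> v}"
        by (auto simp: N_def)
      moreover have "inj_on (head D) {e \<in> out_arcs D v. \<chi> (head D e) = \<chi> v}"
        by (rule inj_on_subset[OF inj[of v]]) auto
      ultimately have "k * card {e \<in> out_arcs D v. \<chi> (head D e) = \<chi> v} \<le> out_degree D v"
        using fin[OF v] inj[of v] by (simp add: N_def card_image out_degree_def)
      then have "real k * real (card {e \<in> out_arcs D v. \<chi> (head D e) = \<chi> v}) \<le> out_degree D v"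
        by (metis of_nat_le_iff of_nat_mult)
      then show "real (card {e \<in> out_arcs D v. \<chi> (head D e) = \<chi> v}) \<le> 1 / real k * real (out_degree D v)"
        using k by (simp add: field_simps)
    next
      assume "infinite (out_arcs D v)"
      then have "infinite {u \<in> N v. \<chi> u \<noteq> \<chi> v}"
        using inf[OF v] inj[of v] by (simp add: N_def finite_image_iff)
      moreover have "{u \<in> N v. \<chi> u \<noteq> \<chi> v} = {u. v \<rightarrow>\<^bsub>D\<^esub> u \<and> \<chi> u \<noteq> \<chi> v}"
        by (auto simp: N_def arcs_ends_def arc_to_ends_def)
      ultimately show "infinite {u. v \<rightarrow>\<^bsub>D\<^esub> u \<and> \<chi> u \<noteq> \<chi> v}" by simp
    }
  qed
  with \<chi> show ?thesis by blast
qed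

end
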